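(* Let $\mathbb{D}=\{d_1,\dots,d_P\}\subset\mathbb{N}$ with $0=d_1<d_2<\dots<d_P$, and let $N\ge P$ be an integer with $\mathbb{D}\subseteq\{0,1,\dots,N-1\}$. Let $\theta\in[-\frac{\pi}{2},\frac{\pi}{2})$, $\alpha>0$, $\epsilon>0$, let $\bm{y}=\alpha\bm{a}_{\mathbb{D}}(\theta)+\bm{n}\in\mathbb{C}^P$ with $\|\bm{n}\|_2\le\epsilon$, and put $\rho=(\alpha/\epsilon)^2$. Let $\hat{\bm{t}}\in\mathbb{C}^N$ be any solution (global minimizer) of $$\underset{\bm{t}\in\mathbb{C}^N}{\text{minimize}}\ \operatorname{rank}\mathcal{T}(\bm{t})\quad\text{subject to}\quad \|\bm{y}-\bm{t}_{\mathbb{D}}\|_2\le\epsilon,\ \ \mathcal{T}(\bm{t})\succeq 0$$ that is of the form $\hat{\bm{t}}=\hat\alpha\,\bm{a}(\hat\theta)$ with $\hat\alpha>0$ and $\hat\theta\in[-\frac{\pi}{2},\frac{\pi}{2})$, and let $$\Delta=\min_{k\in\mathbb{Z}}|\sin\hat\theta-\sin\theta+2k|.$$ Then $$\frac{1}{P}\,|H_{\mathbb{D}}(\Delta)|\ \ge\ 1-\frac{4}{P\rho},\qquad\text{where } H_{\mathbb{D}}(\omega)=\sum_{d\in\mathbb{D}}e^{j\pi d\omega}.$$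
   Context: $j$ is the imaginary unit. For $\theta\in[-\frac{\pi}{2},\frac{\pi}{2})$, $\bm{a}(\theta)\in\mathbb{C}^N$ is the vector with entries $a_i(\theta)=e^{j\pi(i-1)\sin\theta}$, $i=1,\dots,N$, and $\bm{a}_{\mathbb{D}}(\theta)\in\mathbb{C}^P$ has entries $[\bm{a}_{\mathbb{D}}(\theta)]_i=e^{j\pi d_i\sin\theta}$. For $\bm{t}\in\mathbb{C}^N$, $\bm{t}_{\mathbb{D}}\in\mathbb{C}^P$ is the subvector with entries $t_{d_i+1}$, $i=1,\dots,P$. $\mathcal{T}(\bm{t})\in\mathbb{C}^{N\times N}$ denotes the Hermitian Toeplitz matrix whose first column is $\bm{t}$ (so feasibility requires the first entry of $\bm{t}$ to be real), and $\succeq 0$ means positive semidefinite. $|H_{\mathbb{D}}|$ is called the (unweighted) beampattern of the array $\mathbb{D}$, and $\rho$ the signal-to-noise ratio. *)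

theory Defs
  imports
    "HOL-Analysis.L2_Norm"
    "Jordan_Normal_Form.DL_Rank"
    "Jordan_Normal_Form.Schur_Decomposition"
begin

(* Vectors and matrices are 0-indexed, so entry i here is entry i + 1 in 1-based notation.
   The sensor positions d_1 < ... < d_P are a function d used on {1..P} only. *)

definition steering :: "nat \<Rightarrow> real \<Rightarrow> complex vec" where
  "steering N \<theta> = vec N (\<lambda>i. exp (\<i> * of_real (pi * real i * sin \<theta>)))"

definition sub_steering :: "nat \<Rightarrow> (nat \<Rightarrow> nat) \<Rightarrow> real \<Rightarrow> complex vec" where
  "sub_steering P d \<theta> = vec P (\<lambda>i. exp (\<i> * of_real (pi * real (d (i + 1)) * sin \<theta>)))"

definition sub_vec :: "nat \<Rightarrow> (nat \<Rightarrow> nat) \<Rightarrow> complex vec \<Rightarrow> complex vec" where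
  "sub_vec P d t = vec P (\<lambda>i. t $ d (i + 1))"

definition norm2 :: "complex vec \<Rightarrow> real" where
  "norm2 v = L2_set (\<lambda>i. cmod (v $ i)) {..<dim_vec v}"

(* Hermitian exactly when the first entry of t is real; the diagonal carries t $ 0 unchanged. *)
definition toeplitz :: "complex vec \<Rightarrow> complex mat" where
  "toeplitz t = mat (dim_vec t) (dim_vec t)
     (\<lambda>(i, j). if j \<le> i then t $ (i - j) else cnj (t $ (j - i)))"

definition psd :: "complex mat \<Rightarrow> bool" where
  "psd A \<longleftrightarrow> square_mat A \<and> mat_adjoint A = A \<and>
     (\<forall>v \<in> carrier_vec (dim_row A). 0 \<le> Re ((A *\<^sub>v v) \<bullet>c v))"

definition mat_rank :: "complex mat \<Rightarrow> nat" where
  "mat_rank A = vec_space.rank (dim_row A) A"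

definition feasible ::
  "nat \<Rightarrow> nat \<Rightarrow> (nat \<Rightarrow> nat) \<Rightarrow> complex vec \<Rightarrow> real \<Rightarrow> complex vec \<Rightarrow> bool" where
  "feasible N P d y \<epsilon> t \<longleftrightarrow>
     t \<in> carrier_vec N \<and> norm2 (y - sub_vec P d t) \<le> \<epsilon> \<and> psd (toeplitz t)"

definition beam :: "nat set \<Rightarrow> real \<Rightarrow> complex" where
  "beam D \<omega> = (\<Sum>d\<in>D. exp (\<i> * of_real (pi * real d * \<omega>)))"

definition sin_dist :: "real \<Rightarrow> real \<Rightarrow> real" where
  "sin_dist \<phi> \<theta> = (LEAST x. x \<in> range (\<lambda>k::int. \<bar>sin \<phi> - sin \<theta> + 2 * of_int k\<bar>))"

(* The minimum over the infinite set of integer shifts exists, so LEAST is well-defined. *)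
lemma sin_dist_is_min:
  "sin_dist \<phi> \<theta> \<in> range (\<lambda>k::int. \<bar>sin \<phi> - sin \<theta> + 2 * of_int k\<bar>)"
  "sin_dist \<phi> \<theta> \<le> \<bar>sin \<phi> - sin \<theta> + 2 * of_int k\<bar>"
proof -
  define u where "u = sin \<phi> - sin \<theta>"
  define f where "f = (\<lambda>k::int. \<bar>u + 2 * of_int k\<bar>)"
  define m where "m = f (- round (u / 2))"
  have le: "m \<le> f k" for k
    using round_diff_minimal[of "u / 2" "- k"] unfolding m_def f_def by (simp add: abs_if split: if_splits)
  have "sin_dist \<phi> \<theta> = m"
    unfolding sin_dist_def u_def[symmetric] f_def[symmetric]
    by (rule Least_equality) (use le in \<open>auto simp: m_def\<close>)
  then show "sin_dist \<phi> \<theta> \<in> range (\<lambda>k::int. \<bar>sin \<phi> - sin \<theta> + 2 * of_int k\<bar>)"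
    "sin_dist \<phi> \<theta> \<le> \<bar>sin \<phi> - sin \<theta> + 2 * of_int k\<bar>"
    using le[of k] unfolding m_def f_def u_def by (metis rangeI, metis)
qed

end

(* Feasibility gives norm (alpha a - alpha_hat b) <= 2 epsilon for the two subsampled steering
   vectors a, b, whose inner product is H(sin theta_hat - sin theta). Minimising the resulting
   quadratic in alpha_hat yields 1 - (|H| / P)^2 <= 4 / (P rho), and |H| / P <= 1. *)
theory Submission
  imports Defs
begin

text \<open>Positions are integers, so a shift by \<open>2 * of_int k\<close> adds a multiple of 2
  pi to every phase. This periodicity is what makes a minimum over even shifts harmless in the
  definition of \<open>sin_dist\<close>.\<close>

lemma beam_shift: "beam D (\<omega> + 2 * of_int k) = beam D \<omega>"
  unfolding beam_def cis_conv_exp[symmetric]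
proof (rule sum.cong)
  fix d
  have "pi * real d * (\<omega> + 2 * of_int k) = pi * real d * \<omega> + 2 * pi * of_int (int d * k)"
    by (simp add: algebra_simps)
  then show "cis (pi * real d * (\<omega> + 2 * of_int k)) = cis (pi * real d * \<omega>)"
    by (simp only: cis_mult[symmetric] cis_multiple_2pi Ints_of_int mult_1_right)
qed simp

lemma beam_minus: "beam D (- \<omega>) = cnj (beam D \<omega>)"
  unfolding beam_def cis_conv_exp[symmetric] by (simp add: cis_cnj)

text \<open>The wrapped distance differs from the plain difference of sines by an even shift and
  possibly a sign. The shift is absorbed by periodicity, and the sign only conjugates the beam,
  which the modulus does not see.\<close>

lemma cmod_beam_sin_dist: "cmod (beam D (sin_dist \<phi> \<theta>)) = cmod (beam D (sin \<phi> - sin \<theta>))"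
proof -
  obtain k :: int where "sin_dist \<phi> \<theta> = \<bar>sin \<phi> - sin \<theta> + 2 * of_int k\<bar>"
    using sin_dist_is_min(1)[of \<phi> \<theta>] by auto
  then have "cmod (beam D (sin_dist \<phi> \<theta>)) = cmod (beam D (sin \<phi> - sin \<theta> + 2 * of_int k))"
    by (cases "sin \<phi> - sin \<theta> + 2 * of_int k \<ge> 0")
      (simp_all only: abs_of_nonneg abs_of_neg not_le beam_minus complex_mod_cnj)
  then show ?thesis by (simp only: beam_shift)
qed

lemma cmod_beam_le: "cmod (beam D \<omega>) \<le> real (card D)"
  unfolding beam_def by (rule order_trans[OF norm_sum]) simp

text \<open>The bound keeps every sampled index \<open>d (i + 1)\<close> inside the full vector, so
  sampling can be carried out entrywise.\<close>

lemma sub_vec_smult_steering: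
  assumes "\<And>i. i < P \<Longrightarrow> d (i + 1) < N"
  shows "sub_vec P d (c \<cdot>\<^sub>v steering N \<theta>) = c \<cdot>\<^sub>v sub_steering P d \<theta>"
  using assms by (intro eq_vecI) (auto simp: sub_vec_def steering_def sub_steering_def)

lemma norm2_minus_le:
  assumes "u \<in> carrier_vec n" "v \<in> carrier_vec n"
  shows "norm2 (u - v) \<le> norm2 u + norm2 v"
proof -
  have "norm2 (u - v) = L2_set (\<lambda>i. cmod (u $ i - v $ i)) {..<n}"
    using assms unfolding norm2_def by (auto intro!: L2_set_cong)
  also have "\<dots> \<le> L2_set (\<lambda>i. cmod (u $ i) + cmod (v $ i)) {..<n}"
    by (intro L2_set_mono norm_triangle_ineq4) auto
  also have "\<dots> \<le> norm2 u + norm2 v"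
    using assms L2_set_triangle_ineq[of "\<lambda>i. cmod (u $ i)" "\<lambda>i. cmod (v $ i)" "{..<n}"]
    unfolding norm2_def by auto
  finally show ?thesis .
qed

text \<open>Apply the law of cosines in each entry. The cosines of the phase differences add up to
  the real part of the beam, so the beam is the inner product of the two steering vectors.\<close>

lemma norm2_sub_steering_diff:
  assumes "strict_mono_on {1..P} d"
  shows "(norm2 (of_real r \<cdot>\<^sub>v sub_steering P d \<theta> - of_real s \<cdot>\<^sub>v sub_steering P d \<phi>))\<^sup>2
    = real P * r\<^sup>2 + real P * s\<^sup>2 - 2 * r * s * Re (beam (d ` {1..P}) (sin \<phi> - sin \<theta>))"
proof -
  define x where "x \<psi> i = pi * real (d (i + 1)) * sin \<psi>" for \<psi> i
  \<comment> \<open>Distinct positions turn the sum over the set of positions into a sum over their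
    indices.\<close>
  have inj: "inj_on d {1..P}"
    using assms by (rule strict_mono_on_imp_inj_on)
  have "beam (d ` {1..P}) (sin \<phi> - sin \<theta>)
      = (\<Sum>i=1..P. exp (\<i> * of_real (pi * real (d i) * (sin \<phi> - sin \<theta>))))"
    unfolding beam_def sum.reindex[OF inj] comp_def ..
  also have "\<dots> = (\<Sum>i<P. exp (\<i> * of_real (pi * real (d (i + 1)) * (sin \<phi> - sin \<theta>))))"
    \<comment> \<open>Passes from the 1-based numbering of positions to 0-based vector entries:
      entry i belongs to position \<open>d (i + 1)\<close>.\<close>
    by (rule sum.reindex_bij_witness[of _ Suc "\<lambda>i. i - 1"]) auto
  also have "Re \<dots> = (\<Sum>i<P. cos (x \<phi> i - x \<theta> i))"
    by (simp add: x_def Re_exp right_diff_distrib)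
  finally have beam: "Re (beam (d ` {1..P}) (sin \<phi> - sin \<theta>)) = (\<Sum>i<P. cos (x \<phi> i - x \<theta> i))" .
  \<comment> \<open>Law of cosines for two complex numbers with real amplitudes r, s and phases u,
    v.\<close>
  have pt: "(cmod (of_real r * exp (\<i> * of_real u) - of_real s * exp (\<i> * of_real v)))\<^sup>2
      = r\<^sup>2 + s\<^sup>2 - 2 * r * s * cos (v - u)" for u v
  proof -
    have "(cmod (of_real r * exp (\<i> * of_real u) - of_real s * exp (\<i> * of_real v)))\<^sup>2
      = r\<^sup>2 * ((sin u)\<^sup>2 + (cos u)\<^sup>2) + s\<^sup>2 * ((sin v)\<^sup>2 + (cos v)\<^sup>2) - 2 * r * s * cos (v - u)"
      unfolding cmod_power2 cos_diff
      by (simp add: Re_exp Im_exp del: sin_cos_squared_add sin_cos_squared_add2)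
        (simp add: power2_eq_square algebra_simps del: sin_cos_squared_add3)
    then show ?thesis by simp
  qed
  have "(norm2 (of_real r \<cdot>\<^sub>v sub_steering P d \<theta> - of_real s \<cdot>\<^sub>v sub_steering P d \<phi>))\<^sup>2
      = (\<Sum>i<P. (cmod (of_real r * exp (\<i> * of_real (x \<theta> i)) - of_real s * exp (\<i> * of_real (x \<phi> i))))\<^sup>2)"
    by (simp add: norm2_def L2_set_def sum_nonneg sub_steering_def x_def)
  also have "\<dots> = (\<Sum>i<P. r\<^sup>2 + s\<^sup>2 - 2 * r * s * cos (x \<phi> i - x \<theta> i))"
    by (simp only: pt)
  also have "\<dots> = real P * r\<^sup>2 + real P * s\<^sup>2 - 2 * r * s * (\<Sum>i<P. cos (x \<phi> i - x \<theta> i))"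
    by (simp add: sum_subtractf sum.distrib sum_distrib_left algebra_simps)
  finally show ?thesis by (simp only: beam)
qed

theorem mainTheorem2:
  fixes D :: "nat set" and d :: "nat \<Rightarrow> nat" and P N :: nat
    and \<theta> \<alpha> \<epsilon> \<rho> \<alpha>_hat \<theta>_hat \<Delta> :: real
    and y n t_hat :: "complex vec"
  assumes "P \<ge> 1" and "D = d ` {1..P}" and "d 1 = 0" and "strict_mono_on {1..P} d"
    and "P \<le> N" and "D \<subseteq> {..<N}"
    and "\<theta> \<in> {-pi/2..<pi/2}" and "\<alpha> > 0" and "\<epsilon> > 0"
    and "n \<in> carrier_vec P" and "norm2 n \<le> \<epsilon>"
    and "y = complex_of_real \<alpha> \<cdot>\<^sub>v sub_steering P d \<theta> + n"
    and "\<rho> = (\<alpha> / \<epsilon>)\<^sup>2"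
    and "is_arg_min (\<lambda>t. mat_rank (toeplitz t)) (feasible N P d y \<epsilon>) t_hat"
    and "t_hat = complex_of_real \<alpha>_hat \<cdot>\<^sub>v steering N \<theta>_hat"
    and "\<alpha>_hat > 0" and "\<theta>_hat \<in> {-pi/2..<pi/2}"
    and "\<Delta> = sin_dist \<theta>_hat \<theta>"
  shows "1 / real P * cmod (beam D \<Delta>) \<ge> 1 - 4 / (real P * \<rho>)"
proof -
  have dN: "d (i + 1) < N" if "i < P" for i
  proof -
    have "d (i + 1) \<in> D"
      unfolding assms(2) using that by (intro imageI) auto
    with assms(6) show ?thesis by auto
  qed
  define a where "a = complex_of_real \<alpha> \<cdot>\<^sub>v sub_steering P d \<theta>"
  define b where "b = complex_of_real \<alpha>_hat \<cdot>\<^sub>v sub_steering P d \<theta>_hat"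
  have car: "a \<in> carrier_vec P" "b \<in> carrier_vec P"
    by (simp_all add: a_def b_def sub_steering_def)
  have "feasible N P d y \<epsilon> t_hat"
    using assms(14) by (simp add: is_arg_min_def)
  then have "norm2 (y - b) \<le> \<epsilon>"
    unfolding feasible_def assms(15) b_def using sub_vec_smult_steering[of P d N, OF dN] by simp
  \<comment> \<open>Fit residual minus noise: each has norm at most \<epsilon>, so \<open>a\<close>
    and \<open>b\<close> are within 2 \<epsilon>. Squaring this produces the constant 4.\<close>
  moreover have "a - b = (y - b) - n"
    using car assms(10) unfolding assms(12) a_def[symmetric] by (intro eq_vecI) auto
  ultimately have "norm2 (a - b) \<le> 2 * \<epsilon>"
    using norm2_minus_le[of "y - b" P n] car assms(10,11)
    unfolding assms(12) a_def[symmetric] by auto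
  then have "(norm2 (a - b))\<^sup>2 \<le> (2 * \<epsilon>)\<^sup>2"
    by (intro power_mono) (simp_all add: norm2_def)
  define h where "h = cmod (beam D \<Delta>)"
  have h: "h = cmod (beam D (sin \<theta>_hat - sin \<theta>))"
    unfolding h_def assms(18) by (rule cmod_beam_sin_dist)
  have P: "real P > 0"
    using \<open>P \<ge> 1\<close> by simp
  have "card D \<le> P"
    using card_image_le[of "{1..P}" d] assms(2) by simp
  then have "h \<le> real P" "0 \<le> h"
    using cmod_beam_le[of D \<Delta>] by (simp_all add: h_def)
  \<comment> \<open>Both amplitudes are positive, so replacing the real part by the modulus can only
    lower the expanded squared distance.\<close>
  have "\<alpha> * \<alpha>_hat * Re (beam D (sin \<theta>_hat - sin \<theta>)) \<le> \<alpha> * \<alpha>_hat * h"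
    using assms(8,16) unfolding h by (intro mult_left_mono complex_Re_le_cmod) auto
  with \<open>(norm2 (a - b))\<^sup>2 \<le> (2 * \<epsilon>)\<^sup>2\<close>
  have "real P * \<alpha>\<^sup>2 + real P * \<alpha>_hat\<^sup>2 - 2 * \<alpha> * \<alpha>_hat * h \<le> 4 * \<epsilon>\<^sup>2"
    unfolding a_def b_def norm2_sub_steering_diff[OF assms(4)] assms(2)[symmetric] by simp
  \<comment> \<open>The factor P allows completing the square in \<open>\<alpha>_hat\<close> without
    division. The square vanishes at \<open>\<alpha>_hat = \<alpha> * h / real P\<close>; discarding
    it leaves a bound independent of \<open>\<alpha>_hat\<close>.\<close>
  then have "real P * (real P * \<alpha>\<^sup>2 + real P * \<alpha>_hat\<^sup>2 - 2 * \<alpha> * \<alpha>_hat * h) \<le> real P * (4 * \<epsilon>\<^sup>2)"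
    using P by (intro mult_left_mono) auto
  moreover have "real P * (real P * \<alpha>\<^sup>2 + real P * \<alpha>_hat\<^sup>2 - 2 * \<alpha> * \<alpha>_hat * h)
      = (real P * \<alpha>_hat - \<alpha> * h)\<^sup>2 + \<alpha>\<^sup>2 * ((real P)\<^sup>2 - h\<^sup>2)"
    by (simp add: power2_eq_square algebra_simps)
  ultimately have "\<alpha>\<^sup>2 * ((real P)\<^sup>2 - h\<^sup>2) \<le> real P * (4 * \<epsilon>\<^sup>2)"
    by (smt (verit) zero_le_power2)
  \<comment> \<open>Makes the bound linear in h: P^2 - h^2 is at least P (P - h), and the common
    factor P then cancels.\<close>
  moreover have "h\<^sup>2 \<le> real P * h"
    using \<open>h \<le> real P\<close> \<open>0 \<le> h\<close> by (simp add: power2_eq_square mult_right_mono)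
  ultimately have "\<alpha>\<^sup>2 * ((real P)\<^sup>2 - real P * h) \<le> real P * (4 * \<epsilon>\<^sup>2)"
    by (smt (verit) mult_left_mono zero_le_power2)
  then have "real P * (\<alpha>\<^sup>2 * (real P - h)) \<le> real P * (4 * \<epsilon>\<^sup>2)"
    by (simp add: power2_eq_square algebra_simps)
  then have "\<alpha>\<^sup>2 * (real P - h) \<le> 4 * \<epsilon>\<^sup>2"
    using P by simp
  then have "real P - 4 * \<epsilon>\<^sup>2 / \<alpha>\<^sup>2 \<le> h"
    using assms(8) by (simp add: field_simps)
  then have "(real P - 4 * \<epsilon>\<^sup>2 / \<alpha>\<^sup>2) / real P \<le> h / real P"
    using P by (intro divide_right_mono) auto
  \<comment> \<open>Here the ratio of \<epsilon>^2 to \<alpha>^2 is recognised as 1 /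
    \<rho>.\<close>
  moreover have "(real P - 4 * \<epsilon>\<^sup>2 / \<alpha>\<^sup>2) / real P = 1 - 4 / (real P * \<rho>)"
    using P assms(8,9) unfolding assms(13) by (simp add: diff_divide_distrib power_divide)
  ultimately show ?thesis by (simp add: h_def)
qed

end
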